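(* Let $a>b>0$, let $\mathcal{E}$ be the ellipse $(x/a)^2+(y/b)^2=1$, and let $k_7=\sqrt{4a^4-5a^2b^2+b^4}$. Over the iso-$X_7$ family, i.e., the Poncelet family of triangles inscribed in $\mathcal{E}$ whose common incircle has center $\left[\frac{k_7}{2a},0\right]$ and radius $\frac{b^2}{2a}$, the sum of half-angle tangents is conserved and given by $$\sum_{i=1}^{3}\tan\frac{\theta_i}{2}=\frac{\sqrt{4a^2-b^2}}{a},$$ where $\theta_1,\theta_2,\theta_3$ are the internal angles of a triangle of the family.
   Context: Points of the plane are written $[x,y]$. The Poncelet family of triangles inscribed in $\mathcal{E}$ with a given circle as incircle (caustic) is the set of all triangles with vertices on $\mathcal{E}$ whose three sides are tangent to the circle; for the circle given, every point of $\mathcal{E}$ is a vertex of such a triangle. A quantity is conserved if it has the same value for all triangles in the family. *)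

theory Defs
  imports "HOL-Analysis.Analysis"
begin

definition ellipse :: "real \<Rightarrow> real \<Rightarrow> (real ^ 2) set" where
  "ellipse a b = {P. (P $ 1 / a)\<^sup>2 + (P $ 2 / b)\<^sup>2 = 1}"

definition triangle :: "real ^ 2 \<Rightarrow> real ^ 2 \<Rightarrow> real ^ 2 \<Rightarrow> bool" where
  "triangle A B C \<longleftrightarrow> \<not> collinear {A, B, C}"

(* The side is the segment: its line meets the circle in exactly one point,
   and this point of tangency lies on the side itself, not on its extension. *)
definition side_tangent :: "real ^ 2 \<Rightarrow> real ^ 2 \<Rightarrow> real ^ 2 \<Rightarrow> real \<Rightarrow> bool" where
  "side_tangent P Q c r \<longleftrightarrow>
     (\<exists>T. affine hull {P, Q} \<inter> sphere c r = {T} \<and> T \<in> closed_segment P Q)"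

(* An excircle touches only one side within the segment, so for a triangle
   this singles out the inscribed circle. *)
definition is_incircle ::
    "real ^ 2 \<Rightarrow> real ^ 2 \<Rightarrow> real ^ 2 \<Rightarrow> real ^ 2 \<Rightarrow> real \<Rightarrow> bool" where
  "is_incircle A B C c r \<longleftrightarrow>
     side_tangent A B c r \<and> side_tangent B C c r \<and> side_tangent C A c r"

(* Triangles are represented by all orderings of their vertices. *)
definition poncelet_family ::
    "(real ^ 2) set \<Rightarrow> real ^ 2 \<Rightarrow> real \<Rightarrow> ((real ^ 2) \<times> (real ^ 2) \<times> (real ^ 2)) set" where
  "poncelet_family E c r =
     {(A, B, C). triangle A B C \<and> A \<in> E \<and> B \<in> E \<and> C \<in> E \<and> is_incircle A B C c r}"

(* The angle at the vertex B (second argument). *)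
definition internal_angle :: "real ^ 2 \<Rightarrow> real ^ 2 \<Rightarrow> real ^ 2 \<Rightarrow> real" where
  "internal_angle A B C = arccos (((A - B) \<bullet> (C - B)) / (norm (A - B) * norm (C - B)))"

end

theory Submission
  imports Defs
begin

text \<open>
  The ellipse and the circle have double contact: with \<open>c\<close> the center and \<open>r\<close> the radius of the
  circle, the function \<open>(norm (P - c))\<^sup>2 - r\<^sup>2\<close> restricted to the ellipse is the square of an affine
  function of the abscissa of \<open>P\<close>. So the tangent length from a vertex \<open>P\<close> to the incircle is
  \<open>q / 2 - (g / a) * P $ 1\<close> with \<open>q = sqrt (4 * a\<^sup>2 - b\<^sup>2)\<close> and \<open>g = sqrt (a\<^sup>2 - b\<^sup>2)\<close>
  (lemma \<open>tangent_length_on_ellipse\<close>).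

  Let \<open>x\<close>, \<open>y\<close>, \<open>z\<close> be the three tangent lengths of a triangle of the family. Its sides are
  \<open>x + y\<close>, \<open>y + z\<close>, \<open>z + x\<close>, its half-angle tangents are \<open>r / x\<close>, \<open>r / y\<close>, \<open>r / z\<close>, and
  \<open>r\<^sup>2 * (x + y + z) = x * y * z\<close>. Hence the sum of the half-angle tangents is
  \<open>(x * y + y * z + z * x) / (r * (x + y + z))\<close>. The incenter is the barycenter of the vertices with
  the opposite sides as weights. Taking abscissas in this relation and replacing each of them by the
  tangent length, of which it is an affine function, makes
  \<open>x * y + y * z + z * x\<close> a fixed multiple of \<open>x + y + z\<close>, and so the sum is constant.
\<close>

section \<open>Tangent lengths and side lengths\<close>

text \<open>
  The line \<open>P Q\<close> is perpendicular to the radius at \<open>T\<close>: otherwise the reflection of \<open>T\<close> in the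
  perpendicular from \<open>c\<close> to the line would be a second common point of line and circle. Pythagoras
  then gives the distances from \<open>T\<close> to the endpoints, and these add up because \<open>T\<close> lies between them.
\<close>
lemma side_tangent_dist:
  assumes "side_tangent P Q c r" and "P \<noteq> Q"
  shows "dist P Q = sqrt ((dist P c)\<^sup>2 - r\<^sup>2) + sqrt ((dist Q c)\<^sup>2 - r\<^sup>2)"
proof -
  obtain T where T: "affine hull {P, Q} \<inter> sphere c r = {T}" "T \<in> closed_segment P Q"
    using assms(1) unfolding side_tangent_def by blast
  define w where "w = Q - P"
  have ww: "w \<bullet> w > 0" using assms(2) by (simp add: w_def)
  have Tc: "dist c T = r" using T(1) by (metis IntE mem_sphere singletonI)
  obtain t where t: "T = P + t *\<^sub>R w"
    using T(2) by (auto simp: in_segment w_def algebra_simps)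
  \<comment> \<open>the step along the line from \<open>T\<close> to its mirror image\<close>
  define s where "s = - 2 * ((T - c) \<bullet> w) / (w \<bullet> w)"
  define T' where "T' = T + s *\<^sub>R w"
  have "T' = (1 - (t + s)) *\<^sub>R P + (t + s) *\<^sub>R Q"
    by (simp add: T'_def t w_def algebra_simps)
  then have "T' \<in> affine hull {P, Q}"
    unfolding affine_hull_2 by (intro CollectI exI[of _ "1 - (t + s)"] exI[of _ "t + s"]) simp
  moreover have "(T' - c) \<bullet> (T' - c) = (T - c) \<bullet> (T - c) + s * (2 * ((T - c) \<bullet> w) + s * (w \<bullet> w))"
    by (simp add: T'_def inner_simps inner_commute algebra_simps)
  then have "(T' - c) \<bullet> (T' - c) = (T - c) \<bullet> (T - c)"
    using ww by (simp add: s_def)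
  then have "dist c T' = r"
    using Tc by (metis dist_commute dist_norm norm_eq_sqrt_inner)
  ultimately have "T' = T" using T(1) by (metis IntI mem_sphere singletonD)
  then have perp: "(T - c) \<bullet> w = 0" using ww by (simp add: T'_def s_def)
  have pyth: "(dist X T)\<^sup>2 = (dist X c)\<^sup>2 - r\<^sup>2" if "X - T = l *\<^sub>R w" for X l
  proof -
    have "(X - c) \<bullet> (X - c) = (X - T) \<bullet> (X - T) + 2 * ((X - T) \<bullet> (T - c)) + (T - c) \<bullet> (T - c)"
      by (simp add: inner_simps inner_commute)
    moreover have "(X - T) \<bullet> (T - c) = 0"
      using perp by (simp add: that inner_commute)
    moreover have "r\<^sup>2 = (T - c) \<bullet> (T - c)"
      using Tc by (metis dist_norm norm_minus_commute power2_norm_eq_inner)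
    ultimately show ?thesis by (simp add: dist_norm power2_norm_eq_inner)
  qed
  have "(dist P T)\<^sup>2 = (dist P c)\<^sup>2 - r\<^sup>2"
    by (rule pyth[of _ "- t"]) (simp add: t)
  moreover have "(dist Q T)\<^sup>2 = (dist Q c)\<^sup>2 - r\<^sup>2"
    by (rule pyth[of _ "1 - t"]) (simp add: t w_def algebra_simps)
  ultimately have "dist P T = sqrt ((dist P c)\<^sup>2 - r\<^sup>2)" "dist Q T = sqrt ((dist Q c)\<^sup>2 - r\<^sup>2)"
    by (metis real_sqrt_unique zero_le_dist)+
  moreover have "dist P Q = dist P T + dist T Q"
    using T(2) between between_mem_segment by metis
  ultimately show ?thesis by (simp add: dist_commute)
qed

text \<open>
  The law of cosines gives \<open>cos \<theta> = (x * (x + y + z) - y * z) / ((x + y) * (x + z))\<close>, and then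
  \<open>tan (\<theta> / 2) = sin \<theta> / (1 + cos \<theta>)\<close>. The relation between \<open>r\<close> and the tangent lengths
  turns the root \<open>sqrt (x * y * z * (x + y + z))\<close> in \<open>sin \<theta>\<close> into \<open>r * (x + y + z)\<close>.
\<close>
lemma tan_half_internal_angle:
  assumes pos: "x > 0" "y > 0" "z > 0" "r > 0"
    and sides: "dist P Q = x + y" "dist R Q = x + z" "dist P R = y + z"
    and radius: "r\<^sup>2 * (x + y + z) = x * y * z"
  shows "tan (internal_angle P Q R / 2) = r / x"
proof -
  define s where "s = x + y + z"
  have s: "s > 0" using pos by (simp add: s_def)
  define k where "k = (x * s - y * z) / ((x + y) * (x + z))"
  have D: "(x + y) * (x + z) = x * s + y * z" by (simp add: s_def algebra_simps)
  have p: "x * s > 0" "y * z > 0" using pos s by simp_all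
  have "(P - R) \<bullet> (P - R) = (P - Q) \<bullet> (P - Q) + (R - Q) \<bullet> (R - Q) - 2 * ((P - Q) \<bullet> (R - Q))"
    by (simp add: inner_simps inner_commute)
  then have "(y + z)\<^sup>2 = (x + y)\<^sup>2 + (x + z)\<^sup>2 - 2 * ((P - Q) \<bullet> (R - Q))"
    using sides by (simp add: dist_norm flip: power2_norm_eq_inner)
  then have "(P - Q) \<bullet> (R - Q) = x * s - y * z"
    by (simp add: s_def power2_eq_square algebra_simps)
  then have angle: "internal_angle P Q R = arccos k"
    using sides by (simp add: internal_angle_def k_def dist_norm)
  have k1: "1 + k = 2 * (x * s) / (x * s + y * z)" "1 - k = 2 * (y * z) / (x * s + y * z)"
    unfolding k_def D using p by (simp_all add: field_simps)
  have "1 + k > 0" "1 - k > 0" unfolding k1 using p by simp_all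
  then have k: "-1 < k" "k < 1" by simp_all
  have "1 - k\<^sup>2 = (1 + k) * (1 - k)" by (simp add: power2_eq_square algebra_simps)
  also have "\<dots> = 4 * s * (x * y * z) / (x * s + y * z)\<^sup>2"
    unfolding k1 by (simp add: power2_eq_square)
  also have "\<dots> = (2 * (r * s) / (x * s + y * z))\<^sup>2"
    unfolding radius[symmetric] by (simp add: s_def power_divide power2_eq_square)
  finally have "sqrt (1 - k\<^sup>2) = 2 * (r * s) / (x * s + y * z)"
    using p pos s by simp
  moreover have "tan (arccos k / 2) = sqrt (1 - k\<^sup>2) / (1 + k)"
    using k by (simp add: tan_half sin_arccos add.commute)
  ultimately have "tan (arccos k / 2)
      = (2 * (r * s) / (x * s + y * z)) / (2 * (x * s) / (x * s + y * z))"
    by (simp add: k1)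
  also have "\<dots> = r / x"
    using add_pos_pos[OF p] pos s by simp
  finally show ?thesis by (simp add: angle)
qed

section \<open>The incenter as a weighted barycenter\<close>

text \<open>
  In the plane, the vectors orthogonal to a nonzero \<open>N\<close> are the multiples of \<open>N\<close> rotated by a
  right angle, so the sides of the triangle would all be parallel.
\<close>
lemma orthogonal_to_triangle_eq_0:
  fixes A B C N :: "real ^ 2"
  assumes "\<not> collinear {A, B, C}" and "N \<bullet> A = N \<bullet> B" and "N \<bullet> B = N \<bullet> C"
  shows "N = 0"
proof (rule ccontr)
  assume "N \<noteq> 0"
  define n where "n = N $ 1 * N $ 1 + N $ 2 * N $ 2"
  have n: "n \<noteq> 0"
    using \<open>N \<noteq> 0\<close> by (auto simp: n_def vec_eq_iff forall_2 sum_squares_eq_zero_iff)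
  define u :: "real ^ 2" where "u = vector [- N $ 2, N $ 1]"
  have multiple: "\<exists>l. d = l *\<^sub>R u" if "N \<bullet> d = 0" for d :: "real ^ 2"
  proof -
    have d: "N $ 1 * d $ 1 + N $ 2 * d $ 2 = 0"
      using that by (simp add: inner_vec_def sum_2)
    define l where "l = (N $ 1 * d $ 2 - N $ 2 * d $ 1) / n"
    have "d $ 1 * n = (N $ 1 * d $ 2 - N $ 2 * d $ 1) * - N $ 2"
        "d $ 2 * n = (N $ 1 * d $ 2 - N $ 2 * d $ 1) * N $ 1"
      unfolding n_def using d by algebra+
    then have "d $ 1 = l * - N $ 2" "d $ 2 = l * N $ 1"
      by (simp_all only: l_def times_divide_eq_left nonzero_eq_divide_eq[OF n])
    then have "d = l *\<^sub>R u" by (simp add: vec_eq_iff forall_2 u_def)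
    then show ?thesis ..
  qed
  have "collinear {A, B, C}"
    unfolding collinear_def
  proof (rule exI[of _ u], intro ballI)
    fix X Y assume "X \<in> {A, B, C}" "Y \<in> {A, B, C}"
    then have "N \<bullet> (X - Y) = 0" using assms by (auto simp: inner_diff_right)
    then show "\<exists>l. X - Y = l *\<^sub>R u" by (rule multiple)
  qed
  with assms(1) show False by simp
qed

text \<open>
  The tangent lengths determine the Gram matrix of \<open>A - c\<close>, \<open>B - c\<close>, \<open>C - c\<close>. From it, the
  weighted sum \<open>N\<close> of these vectors has the same inner product
  \<open>2 * (r\<^sup>2 * (x + y + z) - x * y * z)\<close> with each of them, so it is orthogonal to the sides of the
  triangle, hence zero. That common value is then zero as well, which is the formula for the
  inradius.
\<close>
lemma incenter_barycenter_and_inradius: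
  fixes A B C c :: "real ^ 2"
  assumes nondeg: "\<not> collinear {A, B, C}"
    and tangents: "(dist A c)\<^sup>2 = x\<^sup>2 + r\<^sup>2" "(dist B c)\<^sup>2 = y\<^sup>2 + r\<^sup>2" "(dist C c)\<^sup>2 = z\<^sup>2 + r\<^sup>2"
    and sides: "dist A B = x + y" "dist B C = y + z" "dist C A = z + x"
  shows "(y + z) *\<^sub>R (A - c) + (z + x) *\<^sub>R (B - c) + (x + y) *\<^sub>R (C - c) = 0"
    and "r\<^sup>2 * (x + y + z) = x * y * z"
proof -
  define u v w where "u = A - c" and "v = B - c" and "w = C - c"
  define N where "N = (y + z) *\<^sub>R u + (z + x) *\<^sub>R v + (x + y) *\<^sub>R w"
  have norms: "u \<bullet> u = x\<^sup>2 + r\<^sup>2" "v \<bullet> v = y\<^sup>2 + r\<^sup>2" "w \<bullet> w = z\<^sup>2 + r\<^sup>2"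
    using tangents by (simp_all add: u_def v_def w_def dist_norm power2_norm_eq_inner)
  have "(u - v) \<bullet> (u - v) = (x + y)\<^sup>2" "(v - w) \<bullet> (v - w) = (y + z)\<^sup>2" "(w - u) \<bullet> (w - u) = (z + x)\<^sup>2"
    unfolding u_def v_def w_def sides[symmetric]
    by (simp_all add: dist_norm power2_norm_eq_inner)
  then have prods: "u \<bullet> v = r\<^sup>2 - x * y" "v \<bullet> w = r\<^sup>2 - y * z" "u \<bullet> w = r\<^sup>2 - z * x"
    using norms
    by (simp_all add: inner_diff_left inner_diff_right inner_commute power2_eq_square algebra_simps)
  have dots: "N \<bullet> d = (y + z) * (u \<bullet> d) + (z + x) * (v \<bullet> d) + (x + y) * (w \<bullet> d)" for d
    by (simp add: N_def inner_add_left)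
  have N: "N \<bullet> u = 2 * (r\<^sup>2 * (x + y + z) - x * y * z)"
      "N \<bullet> v = 2 * (r\<^sup>2 * (x + y + z) - x * y * z)"
      "N \<bullet> w = 2 * (r\<^sup>2 * (x + y + z) - x * y * z)"
    unfolding dots inner_commute[of v u] inner_commute[of w u] inner_commute[of w v] norms prods
    by (simp_all add: power2_eq_square algebra_simps)
  have "N = 0"
  proof (rule orthogonal_to_triangle_eq_0[OF nondeg])
    show "N \<bullet> A = N \<bullet> B" "N \<bullet> B = N \<bullet> C"
      using N by (simp_all add: u_def v_def w_def inner_diff_right)
  qed
  then show "(y + z) *\<^sub>R (A - c) + (z + x) *\<^sub>R (B - c) + (x + y) *\<^sub>R (C - c) = 0"
    by (simp add: N_def u_def v_def w_def)
  show "r\<^sup>2 * (x + y + z) = x * y * z"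
    using N(1) \<open>N = 0\<close> by simp
qed

section \<open>Double contact of the ellipse and the circle\<close>

text \<open>
  On the ellipse, \<open>P $ 2\<close> can be eliminated from the power of \<open>P\<close> with respect to the circle. The
  quadratic polynomial in \<open>P $ 1\<close> that remains has discriminant zero for this center
  and radius. Its double root exceeds \<open>a\<close>, because \<open>2 * g < q\<close>, so the square root below
  is positive on the whole ellipse.
\<close>
lemma tangent_length_on_ellipse:
  fixes a b :: real
  assumes ab: "a > b" "b > 0" and P: "P \<in> ellipse a b"
  defines "q \<equiv> sqrt (4 * a\<^sup>2 - b\<^sup>2)" and "g \<equiv> sqrt (a\<^sup>2 - b\<^sup>2)"
  shows "(dist P (vector [q * g / (2 * a), 0]))\<^sup>2 = (q / 2 - g / a * P $ 1)\<^sup>2 + (b\<^sup>2 / (2 * a))\<^sup>2"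
    and "q / 2 - g / a * P $ 1 > 0"
proof -
  have "b\<^sup>2 < a\<^sup>2" using ab by (simp add: power_strict_mono)
  moreover have "a\<^sup>2 > 0" "b\<^sup>2 > 0" using ab by simp_all
  ultimately have "b\<^sup>2 < 4 * a\<^sup>2" by linarith
  with \<open>b\<^sup>2 < a\<^sup>2\<close> \<open>b\<^sup>2 > 0\<close> have g2: "g\<^sup>2 = a\<^sup>2 - b\<^sup>2" and q2: "q\<^sup>2 = 4 * a\<^sup>2 - b\<^sup>2" and "q > 0" "g > 0"
    and "2 * g < q"
    unfolding q_def g_def
    by (simp_all add: real_less_rsqrt power_mult_distrib)
  have E: "(P $ 1)\<^sup>2 / a\<^sup>2 + (P $ 2)\<^sup>2 / b\<^sup>2 = 1"
    using P by (simp add: ellipse_def power_divide)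
  then have y2: "(P $ 2)\<^sup>2 = b\<^sup>2 - b\<^sup>2 * (P $ 1)\<^sup>2 / a\<^sup>2"
    using ab by (simp add: field_simps)
  have "(dist P (vector [q * g / (2 * a), 0]))\<^sup>2 = (P $ 1 - q * g / (2 * a))\<^sup>2 + (P $ 2)\<^sup>2"
    unfolding dist_norm power2_norm_eq_inner
    by (simp add: inner_vec_def sum_2 power2_eq_square)
  also have "\<dots> = (P $ 1)\<^sup>2 - P $ 1 * q * g / a + q\<^sup>2 * g\<^sup>2 / (4 * a\<^sup>2) + b\<^sup>2 - b\<^sup>2 * (P $ 1)\<^sup>2 / a\<^sup>2"
    unfolding y2 using ab by (simp add: power2_eq_square field_simps)
  also have "\<dots> = q\<^sup>2 / 4 - P $ 1 * q * g / a + g\<^sup>2 / a\<^sup>2 * (P $ 1)\<^sup>2 + b ^ 4 / (4 * a\<^sup>2)"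
    unfolding g2 q2 using ab by (simp add: field_simps power2_eq_square power4_eq_xxxx)
  also have "\<dots> = (q / 2 - g / a * P $ 1)\<^sup>2 + (b\<^sup>2 / (2 * a))\<^sup>2"
    using ab by (simp add: field_simps power2_eq_square power4_eq_xxxx)
  finally show "(dist P (vector [q * g / (2 * a), 0]))\<^sup>2
      = (q / 2 - g / a * P $ 1)\<^sup>2 + (b\<^sup>2 / (2 * a))\<^sup>2" .
  have "(P $ 1)\<^sup>2 / a\<^sup>2 \<le> 1" using E divide_nonneg_nonneg[OF zero_le_power2 zero_le_power2, of "P $ 2" b] by linarith
  then have "(P $ 1)\<^sup>2 \<le> a\<^sup>2" using ab by (simp add: field_simps)
  then have "P $ 1 \<le> a" by (rule power2_le_imp_le) (use ab in simp)
  then have "g / a * P $ 1 \<le> g / a * a" using \<open>g > 0\<close> ab by (intro mult_left_mono) simp_all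
  moreover have "g / a * a = g" using ab by simp
  ultimately show "q / 2 - g / a * P $ 1 > 0" using \<open>2 * g < q\<close> by linarith
qed

section \<open>The conserved sum\<close>

theorem proposition9:
  fixes a b k7 :: real
  assumes "a > b" and "b > 0"
    and "k7 = sqrt (4 * a ^ 4 - 5 * a\<^sup>2 * b\<^sup>2 + b ^ 4)"
  shows "\<forall>(A, B, C) \<in> poncelet_family (ellipse a b) (vector [k7 / (2 * a), 0]) (b\<^sup>2 / (2 * a)).
           tan (internal_angle C A B / 2) + tan (internal_angle A B C / 2)
             + tan (internal_angle B C A / 2) = sqrt (4 * a\<^sup>2 - b\<^sup>2) / a"
proof -
  define q where "q = sqrt (4 * a\<^sup>2 - b\<^sup>2)"
  define g where "g = sqrt (a\<^sup>2 - b\<^sup>2)"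
  define r where "r = b\<^sup>2 / (2 * a)"
  define c :: "real ^ 2" where "c = vector [q * g / (2 * a), 0]"
  have a: "a > 0" and r: "r > 0" using assms by (simp_all add: r_def)
  have "b\<^sup>2 < a\<^sup>2" using assms by (simp add: power_strict_mono)
  then have g2: "g\<^sup>2 = a\<^sup>2 - b\<^sup>2" by (simp add: g_def)
  have k7: "k7 = q * g"
    unfolding assms(3) q_def g_def real_sqrt_mult[symmetric]
    by (simp add: algebra_simps power2_eq_square power4_eq_xxxx)
  have "tan (internal_angle C A B / 2) + tan (internal_angle A B C / 2)
      + tan (internal_angle B C A / 2) = q / a"
    if fam: "(A, B, C) \<in> poncelet_family (ellipse a b) c r" for A B C
  proof -
    have nondeg: "\<not> collinear {A, B, C}"
      and on: "A \<in> ellipse a b" "B \<in> ellipse a b" "C \<in> ellipse a b"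
      and tang: "side_tangent A B c r" "side_tangent B C c r" "side_tangent C A c r"
      using fam by (auto simp: poncelet_family_def triangle_def is_incircle_def)
    have ne: "A \<noteq> B" "B \<noteq> C" "C \<noteq> A"
      using nondeg by (auto simp: insert_commute)
    define x y z
      where "x = q / 2 - g / a * A $ 1" and "y = q / 2 - g / a * B $ 1"
        and "z = q / 2 - g / a * C $ 1"
    note len = tangent_length_on_ellipse[OF assms(1,2), folded q_def g_def, folded c_def r_def]
    have pos: "x > 0" "y > 0" "z > 0"
      unfolding x_def y_def z_def by (intro len(2) on)+
    have tl: "(dist A c)\<^sup>2 = x\<^sup>2 + r\<^sup>2" "(dist B c)\<^sup>2 = y\<^sup>2 + r\<^sup>2" "(dist C c)\<^sup>2 = z\<^sup>2 + r\<^sup>2"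
      unfolding x_def y_def z_def by (intro len(1) on)+
    have sides: "dist A B = x + y" "dist B C = y + z" "dist C A = z + x"
      using side_tangent_dist[OF tang(1) ne(1)] side_tangent_dist[OF tang(2) ne(2)]
        side_tangent_dist[OF tang(3) ne(3)] pos
      by (simp_all add: tl)
    note inc = incenter_barycenter_and_inradius[OF nondeg tl sides]
    have tans: "tan (internal_angle C A B / 2) = r / x"
        "tan (internal_angle A B C / 2) = r / y"
        "tan (internal_angle B C A / 2) = r / z"
      by (rule tan_half_internal_angle[of _ z y] tan_half_internal_angle[of _ x z]
            tan_half_internal_angle[of _ y x];
          use pos r sides inc(2) in \<open>simp add: dist_commute algebra_simps\<close>)+
    \<comment> \<open>the value at the center of the affine function that gives the tangent lengths at the vertices\<close>
    define h where "h = q / 2 - g / a * c $ 1"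
    have "((y + z) *\<^sub>R (A - c) + (z + x) *\<^sub>R (B - c) + (x + y) *\<^sub>R (C - c)) $ 1 = 0"
      by (simp only: inc(1) zero_index)
    then have "(y + z) * (A $ 1 - c $ 1) + (z + x) * (B $ 1 - c $ 1) + (x + y) * (C $ 1 - c $ 1) = 0"
      by simp
    then have "(y + z) * (g / a * (A $ 1 - c $ 1)) + (z + x) * (g / a * (B $ 1 - c $ 1))
        + (x + y) * (g / a * (C $ 1 - c $ 1)) = 0"
      by (metis (no_types) distrib_left mult.left_commute mult_zero_right)
    moreover have "g / a * (A $ 1 - c $ 1) = h - x" "g / a * (B $ 1 - c $ 1) = h - y"
        "g / a * (C $ 1 - c $ 1) = h - z"
      by (simp_all add: x_def y_def z_def h_def right_diff_distrib)
    ultimately have "(y + z) * (h - x) + (z + x) * (h - y) + (x + y) * (h - z) = 0"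
      by (simp only:)
    then have sigma2: "x * y + y * z + z * x = (x + y + z) * h"
      by (simp add: algebra_simps)
    have "h = q / 2 - q * g\<^sup>2 / (2 * a\<^sup>2)"
      by (simp add: h_def c_def power2_eq_square ac_simps)
    also have "\<dots> = r * (q / a)"
      unfolding g2 using a by (simp add: r_def field_simps power2_eq_square)
    finally have lin: "h = r * (q / a)" .
    have "r / x + r / y + r / z = r * (x * y + y * z + z * x) / (x * y * z)"
      using pos by (simp add: field_simps)
    also have "\<dots> = r * ((x + y + z) * (r * (q / a))) / (r\<^sup>2 * (x + y + z))"
      by (simp only: sigma2 lin inc(2))
    also have "\<dots> = q / a"
      using pos r a by (simp add: power2_eq_square add_pos_pos less_imp_neq[THEN not_sym])
    finally show ?thesis by (simp only: tans)
  qed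
  then show ?thesis
    by (auto simp: k7 q_def[symmetric] c_def[symmetric] r_def[symmetric])
qed

end
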